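(* Let $M\in\mathbb{R}^{n\times n}$, $Q\in\mathbb{R}^{n\times m}$, $A\in\mathbb{R}^{p\times n}$, $B\in\mathbb{R}^{p\times m}$, $r\in\mathbb{R}^n$, $b\in\mathbb{R}^p$. The set $\mathcal{X}_{\mathrm{SLCC}}$ is nonempty if and only if there exist vectors $(c_x,c_z)\in\mathbb{R}^n\times\mathbb{R}^m$ such that the primal--dual pair of linear programs (P) and (D) admits an optimal solution $(x^c,z^c;u^c,v^c)$ satisfying $x^c\le u^c$ component-wise.
   Context: The system with linear and complementarity constraints (SLCC) is: find $x\in\mathbb{R}^n$, $z\in\mathbb{R}^m$ with $$Mx+Qz-r\ge 0,\quad Ax+Bz=b,\quad x^T(Mx+Qz-r)=0,\quad x,z\ge 0.$$ Its solution set is $\mathcal{X}_{\mathrm{SLCC}}$. For given $(c_x,c_z)$, problem (P) is $$\min\ c_x^Tx+c_z^Tz\quad\text{s.t.}\quad Mx+Qz\ge r,\ Ax+Bz=b,\ x,z\ge 0,$$ and (the paper's dual) problem (D) is $$\max\ r^Tu+b^Tv\quad\text{s.t.}\quad M^Tu+A^Tv\le c_x,\ \ Q^Tu+B^Tv=c_z,\ \ u\ge 0,\ v\text{ free}.$$ An optimal solution $(x^c,z^c;u^c,v^c)$ of the pair means that $(x^c,z^c)$ and $(u^c,v^c)$ are primal--dual optimal for (P) and (D), with equal objective values. Note that (D) is stated with the equality $Q^Tu+B^Tv=c_z$. *)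

theory Defs
  imports "HOL-Analysis.Analysis"
begin

text \<open>
  A matrix with rows indexed by \<open>'a\<close> and columns indexed by \<open>'b\<close> has type \<open>real^'b^'a\<close>.
  The library order \<open>\<le>\<close> on \<open>real^'a\<close> is the component-wise one, and the scalar product
  of \<open>x\<close> and \<open>y\<close> is written \<open>x \<bullet> y\<close>.
\<close>

definition slcc_set ::
  "real^'n^'n \<Rightarrow> real^'m^'n \<Rightarrow> real^'n^'p \<Rightarrow> real^'m^'p \<Rightarrow> real^'n \<Rightarrow> real^'p
    \<Rightarrow> ((real^'n) \<times> (real^'m)) set" where
  "slcc_set M Q A B r b =
    {(x, z). M *v x + Q *v z - r \<ge> 0 \<and> A *v x + B *v z = b \<and>
             x \<bullet> (M *v x + Q *v z - r) = 0 \<and> x \<ge> 0 \<and> z \<ge> 0}"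

definition primal_objective :: "real^'n \<Rightarrow> real^'m \<Rightarrow> (real^'n) \<times> (real^'m) \<Rightarrow> real" where
  "primal_objective c\<^sub>x c\<^sub>z = (\<lambda>(x, z). c\<^sub>x \<bullet> x + c\<^sub>z \<bullet> z)"

definition primal_feasible ::
  "real^'n^'n \<Rightarrow> real^'m^'n \<Rightarrow> real^'n^'p \<Rightarrow> real^'m^'p \<Rightarrow> real^'n \<Rightarrow> real^'p
    \<Rightarrow> (real^'n) \<times> (real^'m) \<Rightarrow> bool" where
  "primal_feasible M Q A B r b =
    (\<lambda>(x, z). M *v x + Q *v z \<ge> r \<and> A *v x + B *v z = b \<and> x \<ge> 0 \<and> z \<ge> 0)"

definition dual_objective :: "real^'n \<Rightarrow> real^'p \<Rightarrow> (real^'n) \<times> (real^'p) \<Rightarrow> real" where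
  "dual_objective r b = (\<lambda>(u, v). r \<bullet> u + b \<bullet> v)"

text \<open>
  The constraint belonging to \<open>z\<close> is an equality, although \<open>z \<ge> 0\<close> in the primal; so this is
  not the textbook linear programming dual, which would have \<open>\<le>\<close> there.
\<close>

definition dual_feasible ::
  "real^'n^'n \<Rightarrow> real^'m^'n \<Rightarrow> real^'n^'p \<Rightarrow> real^'m^'p \<Rightarrow> real^'n \<Rightarrow> real^'m
    \<Rightarrow> (real^'n) \<times> (real^'p) \<Rightarrow> bool" where
  "dual_feasible M Q A B c\<^sub>x c\<^sub>z =
    (\<lambda>(u, v). transpose M *v u + transpose A *v v \<le> c\<^sub>x \<and>
              transpose Q *v u + transpose B *v v = c\<^sub>z \<and> u \<ge> 0)"

text \<open>
  Equality of the two optimal values is part of the definition: strong duality is not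
  automatic for this dual.
\<close>

definition primal_dual_optimal ::
  "real^'n^'n \<Rightarrow> real^'m^'n \<Rightarrow> real^'n^'p \<Rightarrow> real^'m^'p \<Rightarrow> real^'n \<Rightarrow> real^'p
    \<Rightarrow> real^'n \<Rightarrow> real^'m \<Rightarrow> (real^'n) \<times> (real^'m) \<Rightarrow> (real^'n) \<times> (real^'p) \<Rightarrow> bool" where
  "primal_dual_optimal M Q A B r b c\<^sub>x c\<^sub>z xz uv \<longleftrightarrow>
    is_arg_min (primal_objective c\<^sub>x c\<^sub>z) (primal_feasible M Q A B r b) xz \<and>
    is_arg_max (dual_objective r b) (dual_feasible M Q A B c\<^sub>x c\<^sub>z) uv \<and>
    primal_objective c\<^sub>x c\<^sub>z xz = dual_objective r b uv"

end

theory Submission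
  imports Defs
begin

text \<open>
  The duality gap of a feasible primal--dual pair splits into the complementarity terms
  \<open>u \<bullet> s\<close> and \<open>x \<bullet> d\<close>, where \<open>s = M x + Q z - r\<close> is the primal slack and
  \<open>d = c\<^sub>x - M\<^sup>T u - A\<^sup>T v\<close> the dual slack (\<open>duality_gap\<close>); the variable \<open>z\<close> contributes nothing,
  because its dual constraint is an equality. Both terms are nonnegative, which is weak duality;
  hence a feasible pair is optimal with equal values exactly when both terms vanish
  (\<open>primal_dual_optimal_iff_complementary\<close>).

  If \<open>(x, z)\<close> solves the SLCC, then \<open>u = x\<close>, \<open>v = 0\<close> together with the costs \<open>c\<^sub>x = M\<^sup>T x\<close>,
  \<open>c\<^sub>z = Q\<^sup>T x\<close> makes \<open>d\<close> vanish and turns \<open>u \<bullet> s\<close> into the complementarity term of the SLCC,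
  so this pair is optimal. Conversely, an optimal pair has \<open>u \<bullet> s = 0\<close>, and
  \<open>0 \<le> x \<le> u\<close> squeezes \<open>x \<bullet> s\<close> between \<open>0\<close> and \<open>u \<bullet> s\<close>.
\<close>

lemma inner_nonneg_vec:
  fixes x y :: "real^'a"
  assumes "0 \<le> x" and "0 \<le> y"
  shows "0 \<le> x \<bullet> y"
  using assms by (auto simp: inner_vec_def less_eq_vec_def intro!: sum_nonneg)

lemma duality_gap:
  assumes "primal_feasible M Q A B r b (x, z)"
    and "dual_feasible M Q A B c\<^sub>x c\<^sub>z (u, v)"
  shows "primal_objective c\<^sub>x c\<^sub>z (x, z) - dual_objective r b (u, v)
    = u \<bullet> (M *v x + Q *v z - r) + x \<bullet> (c\<^sub>x - (transpose M *v u + transpose A *v v))"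
proof -
  have b: "b = A *v x + B *v z" and c: "c\<^sub>z = transpose Q *v u + transpose B *v v"
    using assms by (auto simp: primal_feasible_def dual_feasible_def)
  have "c\<^sub>z \<bullet> z = u \<bullet> (Q *v z) + v \<bullet> (B *v z)"
    unfolding c by (simp add: inner_add_left dot_lmul_matrix)
  moreover have "x \<bullet> (transpose M *v u + transpose A *v v) = u \<bullet> (M *v x) + v \<bullet> (A *v x)"
    by (simp add: inner_add_left dot_lmul_matrix inner_commute [of x])
  moreover have "b \<bullet> v = v \<bullet> (A *v x) + v \<bullet> (B *v z)"
    unfolding b by (simp add: inner_add_right inner_commute [of _ v])
  ultimately show ?thesis
    by (simp add: primal_objective_def dual_objective_def inner_add_right inner_diff_right
        inner_commute [of x c\<^sub>x] inner_commute [of u r])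
qed

lemma gap_terms_nonneg:
  assumes "primal_feasible M Q A B r b (x, z)"
    and "dual_feasible M Q A B c\<^sub>x c\<^sub>z (u, v)"
  shows "0 \<le> u \<bullet> (M *v x + Q *v z - r)"
    and "0 \<le> x \<bullet> (c\<^sub>x - (transpose M *v u + transpose A *v v))"
  using assms by (auto simp: primal_feasible_def dual_feasible_def intro!: inner_nonneg_vec)

lemma weak_duality:
  assumes "primal_feasible M Q A B r b xz"
    and "dual_feasible M Q A B c\<^sub>x c\<^sub>z uv"
  shows "dual_objective r b uv \<le> primal_objective c\<^sub>x c\<^sub>z xz"
proof (cases xz, cases uv)
  fix x z u v
  assume "xz = (x, z)" and "uv = (u, v)"
  with assms show ?thesis
    using duality_gap [of M Q A B r b x z c\<^sub>x c\<^sub>z u v]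
      gap_terms_nonneg [of M Q A B r b x z c\<^sub>x c\<^sub>z u v] by simp
qed

text \<open>
  Equal values certify optimality on both sides by weak duality, and the gap, a sum of two
  nonnegative terms, is zero only if both terms are. This replaces the quantification over all
  feasible points by two equations.
\<close>

lemma primal_dual_optimal_iff_complementary:
  "primal_dual_optimal M Q A B r b c\<^sub>x c\<^sub>z (x, z) (u, v) \<longleftrightarrow>
    primal_feasible M Q A B r b (x, z) \<and> dual_feasible M Q A B c\<^sub>x c\<^sub>z (u, v) \<and>
    u \<bullet> (M *v x + Q *v z - r) = 0 \<and>
    x \<bullet> (c\<^sub>x - (transpose M *v u + transpose A *v v)) = 0"
  (is "?opt \<longleftrightarrow> ?P \<and> ?D \<and> ?us = 0 \<and> ?xd = 0")
proof (cases "?P \<and> ?D")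
  case True
  then have P: ?P and D: ?D by auto
  have "?opt \<longleftrightarrow> primal_objective c\<^sub>x c\<^sub>z (x, z) = dual_objective r b (u, v)"
  proof
    assume eq: "primal_objective c\<^sub>x c\<^sub>z (x, z) = dual_objective r b (u, v)"
    have "is_arg_min (primal_objective c\<^sub>x c\<^sub>z) (primal_feasible M Q A B r b) (x, z)"
      using P weak_duality [OF _ D] eq by (auto simp: is_arg_min_linorder)
    moreover have "is_arg_max (dual_objective r b) (dual_feasible M Q A B c\<^sub>x c\<^sub>z) (u, v)"
      using D weak_duality [OF P] by (auto simp: is_arg_max_linorder simp flip: eq)
    ultimately show ?opt
      using eq by (simp add: primal_dual_optimal_def)
  qed (simp add: primal_dual_optimal_def)
  also have "\<dots> \<longleftrightarrow> ?us = 0 \<and> ?xd = 0"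
    using duality_gap [OF P D] gap_terms_nonneg [OF P D] by linarith
  finally show ?thesis
    using True by simp
next
  case False
  then show ?thesis
    by (auto simp: primal_dual_optimal_def is_arg_min_def is_arg_max_def)
qed

theorem theorem4p1:
  fixes M :: "real^'n^'n" and Q :: "real^'m^'n"
    and A :: "real^'n^'p" and B :: "real^'m^'p"
    and r :: "real^'n" and b :: "real^'p"
  shows "slcc_set M Q A B r b \<noteq> {} \<longleftrightarrow>
    (\<exists>(c\<^sub>x :: real^'n) (c\<^sub>z :: real^'m) x z u v.
      primal_dual_optimal M Q A B r b c\<^sub>x c\<^sub>z (x, z) (u, v) \<and> x \<le> u)"
  (is "_ \<longleftrightarrow> ?R")
proof
  assume "slcc_set M Q A B r b \<noteq> {}"
  then obtain x z where "(x, z) \<in> slcc_set M Q A B r b" by auto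
  then have "primal_dual_optimal M Q A B r b (transpose M *v x) (transpose Q *v x) (x, z) (x, 0)"
    by (simp add: slcc_set_def primal_dual_optimal_iff_complementary
        primal_feasible_def dual_feasible_def)
  then show ?R by blast
next
  assume ?R
  then obtain c\<^sub>x c\<^sub>z x z u v
    where "primal_dual_optimal M Q A B r b c\<^sub>x c\<^sub>z (x, z) (u, v)" and "x \<le> u"
    by blast
  then have P: "primal_feasible M Q A B r b (x, z)"
    and us: "u \<bullet> (M *v x + Q *v z - r) = 0"
    by (simp_all add: primal_dual_optimal_iff_complementary)
  let ?s = "M *v x + Q *v z - r"
  have s: "0 \<le> ?s" and x: "0 \<le> x"
    using P by (auto simp: primal_feasible_def)
  have "0 \<le> (u - x) \<bullet> ?s"
    using \<open>x \<le> u\<close> s by (intro inner_nonneg_vec) simp_all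
  then have "x \<bullet> ?s \<le> 0"
    using us by (simp add: inner_diff_left)
  with inner_nonneg_vec [OF x s] have "x \<bullet> ?s = 0" by linarith
  with P have "(x, z) \<in> slcc_set M Q A B r b"
    by (simp add: slcc_set_def primal_feasible_def)
  then show "slcc_set M Q A B r b \<noteq> {}" by blast
qed

end
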